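(* There exists a family $\{H_k\}_k$ of triangulations of the plane, indexed by positive integers $k$, for which $\gamma_c(H_k)-\gamma(H_k)$ grows arbitrarily large; that is, for every integer $M$ there is an index $k$ with $\gamma_c(H_k)-\gamma(H_k)\ge M$.
   Context: Graphs are finite, simple and connected. A planar graph is a graph that can be drawn in the plane so that edges intersect only at their endpoints. A planar graph is maximal, or a triangulation (of the plane), if adding any new edge (between two non-adjacent vertices) creates a graph that is no longer planar. A set $S\subset V(G)$ is a dominating set of $G$ if each vertex of $G$ is either in $S$ or adjacent to a vertex in $S$; it is a connected dominating set if additionally the subgraph of $G$ induced by $S$ is connected. The domination number $\gamma(G)$ is the smallest number of vertices in a dominating set of $G$, and the connected domination number $\gamma_c(G)$ is the smallest number of vertices in a connected dominating set of $G$. *)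

theory Defs
  imports "Graph_Theory.Digraph_Component" "HOL-Analysis.Analysis"
begin

text \<open>
  A finite simple graph is a \<open>pair_graph\<close>, that is, a finite symmetric loop-free digraph: an
  edge between \<open>u\<close> and \<open>v\<close> is the pair of opposite arcs \<open>(u, v)\<close> and \<open>(v, u)\<close>. The name
  \<open>connected\<close> is qualified below, since it also denotes topological connectedness.
\<close>

text \<open>
  A drawing places the vertices at distinct points \<open>p v\<close> of the plane, here the complex plane,
  and draws each edge as a simple curve. The two opposite arcs of an edge carry the same curve,
  traversed in opposite directions. An edge meets no vertex except its ends, and two different
  edges meet at most in the positions of their common end vertices.
\<close>

definition plane_drawing ::
  "'a pair_pre_digraph \<Rightarrow> ('a \<Rightarrow> complex) \<Rightarrow> ('a \<times> 'a \<Rightarrow> real \<Rightarrow> complex) \<Rightarrow> bool" where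
  "plane_drawing G p c \<longleftrightarrow>
     inj_on p (pverts G) \<and>
     (\<forall>(u, v) \<in> parcs G.
        arc (c (u, v)) \<and> pathstart (c (u, v)) = p u \<and> pathfinish (c (u, v)) = p v \<and>
        c (v, u) = reversepath (c (u, v)) \<and>
        path_image (c (u, v)) \<inter> p ` pverts G = {p u, p v}) \<and>
     (\<forall>(u, v) \<in> parcs G. \<forall>(x, y) \<in> parcs G. {u, v} \<noteq> {x, y} \<longrightarrow>
        path_image (c (u, v)) \<inter> path_image (c (x, y)) \<subseteq> p ` ({u, v} \<inter> {x, y}))"

definition planar :: "'a pair_pre_digraph \<Rightarrow> bool" where
  "planar G \<longleftrightarrow> (\<exists>p c. plane_drawing G p c)"

definition add_edge :: "'a pair_pre_digraph \<Rightarrow> 'a \<Rightarrow> 'a \<Rightarrow> 'a pair_pre_digraph" where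
  "add_edge G u v = G\<lparr>parcs := parcs G \<union> {(u, v), (v, u)}\<rparr>"

definition plane_triangulation :: "'a pair_pre_digraph \<Rightarrow> bool" where
  "plane_triangulation G \<longleftrightarrow>
     pair_graph G \<and> Digraph_Component.connected (with_proj G) \<and> planar G \<and>
     (\<forall>u \<in> pverts G. \<forall>v \<in> pverts G. u \<noteq> v \<and> (u, v) \<notin> parcs G \<longrightarrow> \<not> planar (add_edge G u v))"

definition dominating_set :: "'a pair_pre_digraph \<Rightarrow> 'a set \<Rightarrow> bool" where
  "dominating_set G S \<longleftrightarrow>
     S \<subseteq> pverts G \<and> (\<forall>v \<in> pverts G. v \<in> S \<or> (\<exists>u \<in> S. (v, u) \<in> parcs G))"

definition connected_dominating_set :: "'a pair_pre_digraph \<Rightarrow> 'a set \<Rightarrow> bool" where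
  "connected_dominating_set G S \<longleftrightarrow>
     dominating_set G S \<and> Digraph_Component.connected (with_proj G \<restriction> S)"

definition domination_number :: "'a pair_pre_digraph \<Rightarrow> nat" where
  "domination_number G = (LEAST n. \<exists>S. dominating_set G S \<and> card S = n)"

definition connected_domination_number :: "'a pair_pre_digraph \<Rightarrow> nat" where
  "connected_domination_number G = (LEAST n. \<exists>S. connected_dominating_set G S \<and> card S = n)"

end

theory Submission
  imports Defs
begin

text \<open>
  The triangulations are maximal planar extensions of a planar graph that consists of one vertex,
  the pole, and \<open>n\<close> disjoint gadgets. A gadget has seven vertices: a 4-cycle, its rim, whose top
  and bottom are joined to the pole; a hub inside, joined to all other vertices of the gadget; and
  two more vertices inside, in opposite triangles between hub and rim. Hub and these two
  vertices form the core of the gadget.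

  The pole and the hubs dominate the graph, so the domination number of every extension is at
  most \<open>n + 1\<close>. In contrast, a connected dominating set of any planar extension has at least two
  vertices in each gadget, hence at least \<open>2 n\<close> vertices if \<open>n \<ge> 2\<close>. Indeed, no planar extension
  has an edge between a core and the outside of its gadget (\<open>core_neighbours\<close>). As a
  connected dominating set has vertices in all gadgets, it cannot keep to the core of one
  of them and must use the rim (\<open>connected_dominating_meets_rim\<close>). But one rim vertex is not
  enough, because no rim vertex is adjacent to both extra core vertices in any planar extension
  (\<open>rim_misses_core_vertex\<close>), and these can only be dominated from within the gadget.

  A maximal planar extension exists because there are finitely many graphs on the given vertices
  (\<open>maximal_planar_extension\<close>), and it is a triangulation by definition; its faces and its
  additional edges remain unknown, so the bounds are proved for all planar extensions. Two facts
  about the plane remain. The base graph is planar, by an explicit drawing with straight segments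
  (\<open>planar_base\<close>). And the two exclusions above follow from the non-planarity of
  \<open>K\<^sub>3\<^sub>,\<^sub>3\<close>, in a version in which the edges at one vertex may be walks
  (\<open>planar_no_subdivided_K33\<close>). This version expresses that no face of a theta curve touches all
  three of its open arcs (\<open>no_face_meets_three_theta_arcs\<close>), which is derived from the Jordan curve
  theorem and Janiszewski's theorem.
\<close>

section \<open>Theta curves\<close>

text \<open>
  Three arcs from \<open>a\<close> to \<open>b\<close> form a theta curve. Its complement has only three faces, and each
  of them misses one of the three open arcs. The lemma states this in a form that can be applied
  to drawings: each of the three connections is only required to avoid the other two arcs.

  Let \<open>w\<close> be a point on the side of \<open>P \<union> Q\<close> that does not contain \<open>z\<close>. Then \<open>w\<close> and \<open>z\<close> are
  connected off \<open>P \<union> R\<close> (through \<open>q\<close>) and off \<open>Q \<union> R\<close> (through \<open>p\<close>). These two closed curves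
  intersect in the connected set \<open>R\<close>, so Janiszewski's theorem connects \<open>w\<close> and \<open>z\<close> off their
  union, which contradicts the choice of \<open>w\<close>.
\<close>

lemma no_face_meets_three_theta_arcs:
  fixes P Q R :: "real \<Rightarrow> complex"
  assumes P: "arc P" "pathstart P = a" "pathfinish P = b"
    and Q: "arc Q" "pathstart Q = a" "pathfinish Q = b"
    and R: "arc R" "pathstart R = a" "pathfinish R = b"
    and PQ: "path_image P \<inter> path_image Q = {a, b}"
    and PR: "path_image P \<inter> path_image R = {a, b}"
    and QR: "path_image Q \<inter> path_image R = {a, b}"
    and p: "p \<in> path_image P" and q: "q \<in> path_image Q" and r: "r \<in> path_image R"
    and zp: "connected_component (- (path_image Q \<union> path_image R)) z p"
    and zq: "connected_component (- (path_image P \<union> path_image R)) z q"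
    and zr: "connected_component (- (path_image P \<union> path_image Q)) z r"
  shows False
proof -
  define J where "J = P +++ reversepath Q"
  have J: "simple_path J" "pathfinish J = pathstart J"
    unfolding J_def using P Q PQ by (auto intro!: simple_path_join_loop arc_reversepath)
  have imJ: "path_image J = path_image P \<union> path_image Q"
    unfolding J_def using P Q by (simp add: path_image_join)
  note jordan = Jordan_inside_outside[OF J, unfolded imJ]
  let ?J = "path_image P \<union> path_image Q"
  have rnot: "r \<notin> ?J"
    using zr by (auto dest: connected_component_in)
  \<comment> \<open>B is the side of the closed curve through P and Q on which z does not lie.\<close>
  obtain B where B: "B \<inter> ?J = {}" "frontier B = ?J"
      "Topological_Spaces.connected B" "\<And>w. w \<in> B \<Longrightarrow> \<not> connected_component (- ?J) z w"
  proof -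
    have nocross: "\<not> connected_component (- ?J) u w" if "u \<in> inside ?J" "w \<in> outside ?J" for u w
      using that inside_same_component[of ?J u w]
      by (metis (no_types, lifting) IntI empty_iff inside_Int_outside)
    have "z \<in> inside ?J \<union> outside ?J"
      using zr[THEN connected_component_in] inside_Un_outside[of ?J] by blast
    then show ?thesis
    proof
      assume "z \<in> inside ?J"
      then show ?thesis using that[of "outside ?J"] jordan nocross
        by (metis Int_commute outside_no_overlap)
    next
      assume "z \<in> outside ?J"
      then show ?thesis using that[of "inside ?J"] jordan nocross
        by (metis Int_commute connected_component_sym inside_no_overlap)
    qed
  qed
  \<comment> \<open>The open arc R lies on the side of z, since it contains r; so B is a face of the whole
    theta curve. As every point of P and Q is a limit of points of B, the point z can be joined
    to B while avoiding R and one of P, Q.\<close>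
  have conR: "Topological_Spaces.connected (path_image R - {a, b})"
    using connected_simple_path_endless[of R] R arc_imp_simple_path by auto
  have BR: "B \<inter> path_image R = {}"
  proof (rule ccontr)
    assume "B \<inter> path_image R \<noteq> {}"
    then obtain w where w: "w \<in> B" "w \<in> path_image R" by auto
    have "a \<in> ?J" "b \<in> ?J" using PQ by auto
    then have "w \<in> path_image R - {a, b}" "r \<in> path_image R - {a, b}"
      using w B rnot r by auto
    moreover have "path_image R - {a, b} \<subseteq> - ?J" using PR QR by blast
    ultimately have "connected_component (- ?J) r w"
      using conR unfolding connected_component_def by blast
    then show False using B(4)[OF w(1)] zr connected_component_trans by blast
  qed
  have reach: "connected_component (- (C \<union> path_image R)) w z"
    if w: "w \<in> B" and s: "s \<in> ?J" "connected_component (- (C \<union> path_image R)) z s"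
      and C: "C \<subseteq> ?J" "closed C" for C s w
  proof -
    let ?U = "- (C \<union> path_image R)"
    have "open ?U" using C R by (auto intro!: open_Compl closed_Un closed_arc_image)
    moreover have "s \<in> ?U" using s connected_component_in by fastforce
    moreover have "s \<in> closure B" using s B(2) by (auto simp: frontier_def)
    ultimately obtain e where e: "e > 0" "ball s e \<subseteq> ?U" 
      using openE by blast
    obtain w' where w': "w' \<in> B" "dist w' s < e"
      using \<open>s \<in> closure B\<close> e closure_approachable by blast
    have "connected_component ?U w w'"
      unfolding connected_component_def using B(1,3) BR w w' C by (intro exI[of _ B]) blast
    moreover have "connected_component ?U w' s"
      unfolding connected_component_def using e w'
      by (intro exI[of _ "ball s e"]) (auto simp: dist_commute)
    ultimately show ?thesis
      using s connected_component_trans connected_component_sym by metis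
  qed
  have "B \<noteq> {}" using B(2) PQ by auto
  then obtain w where w: "w \<in> B" by auto
  have "connected_component (- ((path_image P \<union> path_image R) \<union> (path_image Q \<union> path_image R))) w z"
  proof (rule Janiszewski)
    show "compact (path_image P \<union> path_image R)" "closed (path_image Q \<union> path_image R)"
      using P Q R by (auto intro!: compact_Un closed_Un compact_arc_image closed_arc_image)
    have "(path_image P \<union> path_image R) \<inter> (path_image Q \<union> path_image R) = path_image R"
      using PQ PR by blast
    then show "Topological_Spaces.connected
        ((path_image P \<union> path_image R) \<inter> (path_image Q \<union> path_image R))"
      using R connected_arc_image by simp
    show "connected_component (- (path_image P \<union> path_image R)) w z"
      using reach[OF w, of q "path_image P"] q zq P closed_arc_image by auto
    show "connected_component (- (path_image Q \<union> path_image R)) w z"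
      using reach[OF w, of p "path_image Q"] p zp Q closed_arc_image by auto
  qed
  then have "connected_component (- ?J) w z"
    by (rule connected_component_of_subset) auto
  then show False using B(4)[OF w] connected_component_sym by blast
qed

section \<open>Non-planarity of the complete bipartite graph on three and three vertices\<close>

lemma plane_drawing_arcD:
  assumes "plane_drawing G p c" "(u, v) \<in> parcs G"
  shows "arc (c (u, v))" "pathstart (c (u, v)) = p u" "pathfinish (c (u, v)) = p v"
    "path_image (c (u, v)) \<inter> p ` pverts G = {p u, p v}"
  using assms unfolding plane_drawing_def by fast+

lemma plane_drawing_arcs_inter:
  assumes "plane_drawing G p c" "(u, v) \<in> parcs G" "(x, y) \<in> parcs G" "{u, v} \<noteq> {x, y}"
  shows "path_image (c (u, v)) \<inter> path_image (c (x, y)) \<subseteq> p ` ({u, v} \<inter> {x, y})"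
  using assms unfolding plane_drawing_def by fast

text \<open>
  The pairs joined by a possibly trivial walk outside \<open>A\<close>. Since every vertex is related to
  itself, membership of the ends in the vertex set or in the complement of \<open>A\<close> has to be
  required separately.
\<close>

definition walk_avoiding :: "'a pair_pre_digraph \<Rightarrow> 'a set \<Rightarrow> 'a rel" where
  "walk_avoiding G A = (parcs G \<inter> (- A) \<times> (- A))\<^sup>*"

lemma walk_avoiding_arc:
  "(u, v) \<in> parcs G \<Longrightarrow> u \<notin> A \<Longrightarrow> v \<notin> A \<Longrightarrow> (u, v) \<in> walk_avoiding G A"
  unfolding walk_avoiding_def by auto

lemma walk_avoiding_trans:
  "(u, v) \<in> walk_avoiding G A \<Longrightarrow> (v, w) \<in> walk_avoiding G A \<Longrightarrow> (u, w) \<in> walk_avoiding G A"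
  unfolding walk_avoiding_def by auto

text \<open>
  Edges without a common end have disjoint curves, so a walk that avoids \<open>A\<close> traces a connected
  set off the curves of all edges inside \<open>A\<close>.
\<close>

lemma walk_avoiding_connected_component:
  assumes G: "pair_graph G" and dr: "plane_drawing G p c" and E: "E \<subseteq> parcs G \<inter> A \<times> A"
    and walk: "(z, w) \<in> walk_avoiding G A" and z: "z \<in> pverts G" "z \<notin> A"
  shows "connected_component (- (\<Union>e\<in>E. path_image (c e))) (p z) (p w)"
  using walk unfolding walk_avoiding_def
proof (induction rule: rtrancl_induct)
  interpret G: pair_graph G by fact
  case base
  have "p z \<notin> path_image (c (u, v))" if "(u, v) \<in> E" for u v
  proof
    assume "p z \<in> path_image (c (u, v))"
    then have "p z \<in> {p u, p v}" using plane_drawing_arcD(4)[OF dr, of u v] that E z by blast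
    moreover have "u \<in> pverts G" "v \<in> pverts G" using that E G.wellformed' by blast+
    ultimately have "z \<in> {u, v}" 
      using dr z unfolding plane_drawing_def inj_on_def by auto
    then show False using that E z by auto
  qed
  then have "p z \<in> - (\<Union>e\<in>E. path_image (c e))" by auto
  then show ?case by simp
next
  case (step u v)
  then have uv: "(u, v) \<in> parcs G" "u \<notin> A" "v \<notin> A" by auto
  have "path_image (c (u, v)) \<inter> path_image (c (x, y)) = {}" if "(x, y) \<in> E" for x y
  proof -
    have xy: "(x, y) \<in> parcs G" "{u, v} \<inter> {x, y} = {}" using that E uv by auto
    then have "{u, v} \<noteq> {x, y}" by auto
    then show ?thesis using plane_drawing_arcs_inter[OF dr uv(1) xy(1)] xy(2) by auto
  qed
  then have "path_image (c (u, v)) \<subseteq> - (\<Union>e\<in>E. path_image (c e))" by auto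
  moreover have "p u \<in> path_image (c (u, v))" "p v \<in> path_image (c (u, v))"
    using plane_drawing_arcD(2,3)[OF dr uv(1)]
    by (metis pathstart_in_path_image, metis pathfinish_in_path_image)
  moreover have "Topological_Spaces.connected (path_image (c (u, v)))"
    using plane_drawing_arcD(1)[OF dr uv(1)] connected_arc_image by blast
  ultimately have "connected_component (- (\<Union>e\<in>E. path_image (c e))) (p u) (p v)"
    unfolding connected_component_def by blast
  then show ?case using step.IH connected_component_trans by blast
qed

text \<open>
  The graph \<open>K\<^sub>3\<^sub>,\<^sub>3\<close> with parts \<open>{a, b, z}\<close> and \<open>{q1, q2, q3}\<close> is not planar, even if the edges at
  \<open>z\<close> are replaced by walks: the paths \<open>a q\<^sub>i b\<close> are drawn as a theta curve, and the walk from
  \<open>z\<close> to \<open>q\<^sub>i\<close> only has to avoid the other two paths. The walks may meet each other.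
\<close>

lemma planar_no_subdivided_K33:
  assumes G: "pair_graph G" and pl: "planar G"
    and dist: "distinct [a, b, z, q1, q2, q3]"
    and aq: "(a, q1) \<in> parcs G" "(a, q2) \<in> parcs G" "(a, q3) \<in> parcs G"
    and bq: "(b, q1) \<in> parcs G" "(b, q2) \<in> parcs G" "(b, q3) \<in> parcs G"
    and zq: "(z, q1) \<in> walk_avoiding G {a, b, q2, q3}" "(z, q2) \<in> walk_avoiding G {a, b, q1, q3}"
      "(z, q3) \<in> walk_avoiding G {a, b, q1, q2}"
  shows False
proof -
  interpret G: pair_graph G by fact
  obtain p c where dr: "plane_drawing G p c" using pl planar_def by blast
  define A where "A q = c (a, q) +++ c (q, b)" for q
  let ?Q = "{q1, q2, q3}"
  have arcs: "(a, q) \<in> parcs G" "(q, b) \<in> parcs G" if "q \<in> ?Q" for q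
    using that aq bq G.arcs_symmetric by auto
  have im: "path_image (A q) = path_image (c (a, q)) \<union> path_image (c (q, b))" if "q \<in> ?Q" for q
    using plane_drawing_arcD[OF dr] arcs[OF that] by (auto simp: A_def path_image_join)
  have A: "arc (A q)" "pathstart (A q) = p a" "pathfinish (A q) = p b" if "q \<in> ?Q" for q
  proof -
    have "path_image (c (a, q)) \<inter> path_image (c (q, b)) \<subseteq> {p q}"
      using plane_drawing_arcs_inter[OF dr arcs[OF that]] dist that by (auto simp: doubleton_eq_iff)
    then show "arc (A q)" "pathstart (A q) = p a" "pathfinish (A q) = p b"
      using plane_drawing_arcD[OF dr] arcs[OF that] by (auto simp: A_def intro!: arc_join)
  qed
  have AA: "path_image (A q) \<inter> path_image (A q') = {p a, p b}"
    if q: "q \<in> ?Q" "q' \<in> ?Q" "q \<noteq> q'" for q q'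
  proof
    note i = plane_drawing_arcs_inter[OF dr]
    have "path_image (c (a, q)) \<inter> path_image (c (a, q')) \<subseteq> {p a, p b}"
      using i[OF arcs(1)[OF q(1)] arcs(1)[OF q(2)]] dist q by (auto simp: doubleton_eq_iff)
    moreover have "path_image (c (a, q)) \<inter> path_image (c (q', b)) \<subseteq> {p a, p b}"
      using i[OF arcs(1)[OF q(1)] arcs(2)[OF q(2)]] dist q by (auto simp: doubleton_eq_iff)
    moreover have "path_image (c (q, b)) \<inter> path_image (c (a, q')) \<subseteq> {p a, p b}"
      using i[OF arcs(2)[OF q(1)] arcs(1)[OF q(2)]] dist q by (auto simp: doubleton_eq_iff)
    moreover have "path_image (c (q, b)) \<inter> path_image (c (q', b)) \<subseteq> {p a, p b}"
      using i[OF arcs(2)[OF q(1)] arcs(2)[OF q(2)]] dist q by (auto simp: doubleton_eq_iff)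
    ultimately show "path_image (A q) \<inter> path_image (A q') \<subseteq> {p a, p b}"
      unfolding im[OF q(1)] im[OF q(2)] by blast
    show "{p a, p b} \<subseteq> path_image (A q) \<inter> path_image (A q')"
      using A[OF q(1)] A[OF q(2)]
      by (metis Int_iff empty_subsetI insert_subset pathfinish_in_path_image pathstart_in_path_image)
  qed
  have mid: "p q \<in> path_image (A q)" if "q \<in> ?Q" for q
    using im[OF that] plane_drawing_arcD(4)[OF dr] arcs[OF that] by blast
  have zV: "z \<in> pverts G"
    using zq(1) dist G.wellformed' unfolding walk_avoiding_def by (auto elim: converse_rtranclE)
  have off: "connected_component (- (path_image (A q) \<union> path_image (A q'))) (p z) (p w)"
    if q: "q \<in> ?Q" "q' \<in> ?Q" and w: "(z, w) \<in> walk_avoiding G {a, b, q, q'}" for q q' w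
    using walk_avoiding_connected_component[OF G dr _ w zV,
        of "{(a, q), (q, b), (a, q'), (q', b)}"] arcs q dist
    by (auto simp: im Un_assoc)
  have neq: "q1 \<noteq> q2" "q1 \<noteq> q3" "q2 \<noteq> q3" using dist by auto
  show False
    by (rule no_face_meets_three_theta_arcs[of "A q1" "p a" "p b" "A q2" "A q3"
          "p q1" "p q2" "p q3" "p z"]) (use A AA mid off zq neq in auto)
qed

lemma planar_no_K33:
  assumes G: "pair_graph G" and pl: "planar G"
    and dist: "distinct [a, b, z, q1, q2, q3]"
    and "\<forall>u \<in> {a, b, z}. \<forall>q \<in> {q1, q2, q3}. (u, q) \<in> parcs G"
  shows False
  by (rule planar_no_subdivided_K33[OF G pl dist])
     (use assms(3,4) in \<open>auto intro!: walk_avoiding_arc\<close>)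

section \<open>Maximal planar extensions and connectedness\<close>

lemma pair_graph_iff:
  "pair_graph G \<longleftrightarrow> finite (pverts G) \<and> parcs G \<subseteq> pverts G \<times> pverts G \<and>
     sym (parcs G) \<and> irrefl (parcs G)"
proof
  assume "pair_graph G"
  then interpret G: pair_graph G .
  show "finite (pverts G) \<and> parcs G \<subseteq> pverts G \<times> pverts G \<and>
     sym (parcs G) \<and> irrefl (parcs G)"
    using G.pair_finite_verts G.wellformed' G.arcs_symmetric G.no_loops'[of v v for v]
    unfolding irrefl_def sym_def by auto
next
  assume *: "finite (pverts G) \<and> parcs G \<subseteq> pverts G \<times> pverts G \<and>
     sym (parcs G) \<and> irrefl (parcs G)"
  then have "finite (parcs G)" by (meson finite_SigmaI finite_subset)
  then show "pair_graph G"
    using * by unfold_locales (auto simp: symmetric_def irrefl_def)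
qed

lemma connected_with_more_arcs:
  assumes "Digraph_Component.connected (with_proj G)" "pverts H = pverts G" "parcs G \<subseteq> parcs H"
  shows "Digraph_Component.connected (with_proj H)"
proof -
  have "(parcs G)\<^sup>s \<subseteq> (parcs H)\<^sup>s" using assms(3) by (auto simp: symcl_def)
  then have "(u, v) \<in> rtrancl_on (pverts G) ((parcs H)\<^sup>s)"
    if "(u, v) \<in> rtrancl_on (pverts G) ((parcs G)\<^sup>s)" for u v
    using that by (auto intro: rtrancl_on_mono)
  then show ?thesis
    using assms(1,2) by (simp add: connected_conv)
qed

text \<open>
  This lemma supplies the triangulations without exhibiting them: a planar graph on a finite
  vertex set stays below a planar graph with an inclusion-maximal set of arcs, and that graph is
  a triangulation by definition. A lower bound for such a graph must then hold for every planar
  extension.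
\<close>

lemma maximal_planar_extension:
  assumes G: "pair_graph G" and pl: "planar G" and con: "Digraph_Component.connected (with_proj G)"
  obtains H where "plane_triangulation H" "pverts H = pverts G" "parcs G \<subseteq> parcs H"
proof -
  let ?H = "\<lambda>R. \<lparr>pverts = pverts G, parcs = R\<rparr>"
  define \<A> where "\<A> = {R. parcs G \<subseteq> R \<and> pair_graph (?H R) \<and> planar (?H R)}"
  have "\<A> \<subseteq> Pow (pverts G \<times> pverts G)" unfolding \<A>_def by (auto simp: pair_graph_iff)
  moreover have "finite (pverts G)" using G by (simp add: pair_graph_iff)
  ultimately have "finite \<A>" by (meson finite_Pow_iff finite_SigmaI finite_subset)
  moreover have "parcs G \<in> \<A>" using G pl by (cases G) (simp add: \<A>_def)
  ultimately obtain R where R: "R \<in> \<A>" "\<And>R'. R' \<in> \<A> \<Longrightarrow> R \<subseteq> R' \<Longrightarrow> R' = R"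
    using finite_has_maximal[of \<A>] by (metis empty_iff)
  have "\<not> planar (add_edge (?H R) u v)"
    if uv: "u \<in> pverts G" "v \<in> pverts G" "u \<noteq> v" "(u, v) \<notin> R" for u v
  proof
    let ?R = "R \<union> {(u, v), (v, u)}"
    assume "planar (add_edge (?H R) u v)"
    then have "?R \<in> \<A>"
      using R(1) uv by (auto simp: \<A>_def add_edge_def pair_graph_iff irrefl_def sym_def)
    then show False using R(2)[of ?R] uv by auto
  qed
  then have "plane_triangulation (?H R)"
    using R(1) connected_with_more_arcs[OF con, of "?H R"]
    unfolding plane_triangulation_def \<A>_def by auto
  then show ?thesis using that R(1) by (auto simp: \<A>_def)
qed

lemma connected_cut_arc:
  assumes con: "Digraph_Component.connected (with_proj G \<restriction> S)" and sym: "sym (parcs G)"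
    and u: "u \<in> S" "u \<in> X" and v: "v \<in> S" "v \<notin> X"
  obtains x y where "x \<in> S" "x \<in> X" "y \<in> S" "y \<notin> X" "(x, y) \<in> parcs G"
proof -
  let ?r = "(arcs_ends (with_proj G \<restriction> S))\<^sup>s"
  have r: "?r \<subseteq> parcs G"
  proof -
    have "arcs_ends (with_proj G \<restriction> S) \<subseteq> parcs G"
      unfolding arcs_ends_conv induce_subgraph_def by auto
    then show ?thesis using sym unfolding symcl_def sym_def by fast
  qed
  have "(u, v) \<in> rtrancl_on S ?r"
    using con u v by (simp add: connected_conv)
  then have "v \<notin> X \<longrightarrow> (\<exists>x y. x \<in> S \<and> x \<in> X \<and> y \<in> S \<and> y \<notin> X \<and> (x, y) \<in> parcs G)"
  proof (induction rule: rtrancl_on_induct)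
    case base
    then show ?case using u by simp
  next
    case (step x y)
    then show ?case using r by blast
  qed
  then show ?thesis using that v by blast
qed

lemma connectedI_root:
  assumes "s \<in> pverts G" "sym (parcs G)"
    "\<And>v. v \<in> pverts G \<Longrightarrow> (s, v) \<in> rtrancl_on (pverts G) (parcs G)"
  shows "Digraph_Component.connected (with_proj G)"
proof -
  have eq: "(parcs G)\<^sup>s = parcs G"
    using assms(2) unfolding symcl_def sym_def by fast
  show ?thesis
    unfolding connected_conv with_proj_simps eq
  proof (intro conjI ballI)
    show "pverts G \<noteq> {}" using assms(1) by auto
    fix u v assume "u \<in> pverts G" "v \<in> pverts G"
    then show "(u, v) \<in> rtrancl_on (pverts G) (parcs G)"
      using assms(3) rtrancl_on_sym[OF assms(2), THEN symD] by (metis rtrancl_on_trans)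
  qed
qed

lemma domination_number_le:
  "dominating_set G S \<Longrightarrow> domination_number G \<le> card S"
  unfolding domination_number_def by (rule Least_le) auto

text \<open>
  Connectedness of the graph makes the set of all vertices a connected dominating set, so that
  the minimum in the definition is attained.
\<close>

lemma connected_domination_number_ge:
  assumes G: "pair_graph G" and con: "Digraph_Component.connected (with_proj G)"
    and bd: "\<And>S. connected_dominating_set G S \<Longrightarrow> m \<le> card S"
  shows "m \<le> connected_domination_number G"
proof -
  have "Digraph_Component.connected (with_proj G \<restriction> pverts G)"
  proof -
    have "with_proj G \<restriction> pverts G = with_proj G"
      using G by (auto simp: induce_subgraph_def with_proj_def pair_graph_iff)
    then show ?thesis using con by simp
  qed
  then have "connected_dominating_set G (pverts G)"
    by (simp add: connected_dominating_set_def dominating_set_def)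
  then have "\<exists>S. connected_dominating_set G S \<and> card S = connected_domination_number G"
    unfolding connected_domination_number_def by (rule_tac LeastI_ex) blast
  then show ?thesis using bd by metis
qed

section \<open>Straight-line drawings\<close>

lemma in_segment_from:
  assumes "z \<in> closed_segment a b"
  obtains s where "0 \<le> s" "s \<le> 1" "z = a + s *\<^sub>R (b - a)"
proof -
  obtain u where "0 \<le> u" "u \<le> 1" "z = (1 - u) *\<^sub>R a + u *\<^sub>R b"
    using assms unfolding in_segment by blast
  then show ?thesis using that[of u] by (simp add: algebra_simps)
qed

text \<open>
  Two segments with a common end meet elsewhere only if one of them ends on the other, and this
  is a vertex on an edge. So it suffices to compare vertices with edges, and edges without a
  common end. The set \<open>E\<close> may contain each edge in one direction only, which avoids treating all
  four orientations of a pair of edges.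
\<close>

lemma straight_line_drawing:
  fixes p :: "'a \<Rightarrow> complex"
  assumes G: "pair_graph G" and E: "parcs G = E \<union> E\<inverse>" and inj: "inj_on p (pverts G)"
    and vert: "\<And>u v w. (u, v) \<in> E \<Longrightarrow> w \<in> pverts G \<Longrightarrow> w \<noteq> u \<Longrightarrow> w \<noteq> v \<Longrightarrow>
                 p w \<notin> closed_segment (p u) (p v)"
    and edge: "\<And>u v x y. (u, v) \<in> E \<Longrightarrow> (x, y) \<in> E \<Longrightarrow> {u, v} \<inter> {x, y} = {} \<Longrightarrow>
                 closed_segment (p u) (p v) \<inter> closed_segment (p x) (p y) = {}"
  shows "planar G"
proof -
  have V: "u \<in> pverts G" "v \<in> pverts G" "u \<noteq> v" if "(u, v) \<in> parcs G" for u v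
    using that G by (auto simp: pair_graph_iff irrefl_def)
  have vert': "p w \<notin> closed_segment (p u) (p v)"
    if "(u, v) \<in> parcs G" "w \<in> pverts G" "w \<noteq> u" "w \<noteq> v" for u v w
    using that vert[of u v w] vert[of v u w] by (auto simp: E closed_segment_commute)
  have edge': "closed_segment (p u) (p v) \<inter> closed_segment (p x) (p y) = {}"
    if "(u, v) \<in> parcs G" "(x, y) \<in> parcs G" "{u, v} \<inter> {x, y} = {}" for u v x y
    using that edge[of u v x y] edge[of u v y x] edge[of v u x y] edge[of v u y x]
    by (auto simp: E closed_segment_commute insert_commute)
  \<comment> \<open>Two segments from a common end which meet elsewhere point in the same direction,
    so the shorter one ends on the longer one.\<close>
  have share: "closed_segment (p u) (p v) \<inter> closed_segment (p u) (p w) \<subseteq> {p u}"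
    if uv: "(u, v) \<in> parcs G" and uw: "(u, w) \<in> parcs G" and "v \<noteq> w" for u v w
  proof
    fix z assume z: "z \<in> closed_segment (p u) (p v) \<inter> closed_segment (p u) (p w)"
    obtain s where s: "0 \<le> s" "z = p u + s *\<^sub>R (p v - p u)"
      using z in_segment_from by blast
    obtain t where t: "0 \<le> t" "z = p u + t *\<^sub>R (p w - p u)"
      using z in_segment_from by blast
    have on: "p a \<in> closed_segment (p u) (p b)"
      if "0 \<le> t'" "t' \<le> s'" "0 < s'" "s' *\<^sub>R (p a - p u) = t' *\<^sub>R (p b - p u)" for a b s' t'
    proof -
      have "p a - p u = (t' / s') *\<^sub>R (p b - p u)"
        using that(3) arg_cong[OF that(4), of "\<lambda>x. (1 / s') *\<^sub>R x"] by simp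
      then have "p a = (1 - t' / s') *\<^sub>R p u + (t' / s') *\<^sub>R p b"
        by (simp add: algebra_simps)
      moreover have "0 \<le> t' / s'" "t' / s' \<le> 1" using that by auto
      ultimately show ?thesis unfolding in_segment by blast
    qed
    have eq: "s *\<^sub>R (p v - p u) = t *\<^sub>R (p w - p u)" using s t by simp
    have "s = 0 \<or> t = 0"
    proof (rule ccontr)
      assume "\<not> (s = 0 \<or> t = 0)"
      then have "p v \<in> closed_segment (p u) (p w) \<or> p w \<in> closed_segment (p u) (p v)"
        using on[of t s v w] on[of s t w v] s(1) t(1) eq by (cases "t \<le> s") auto
      then show False using vert'[OF uw, of v] vert'[OF uv, of w] V[OF uv] V[OF uw] \<open>v \<noteq> w\<close> by auto
    qed
    then show "z \<in> {p u}" using s(2) t(2) by auto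
  qed
  have "plane_drawing G p (\<lambda>(u, v). linepath (p u) (p v))"
    unfolding plane_drawing_def
  proof (intro conjI ballI, goal_cases)
    case 1
    then show ?case by (rule inj)
  next
    case (2 e)
    obtain u v where e: "e = (u, v)" by (cases e)
    with 2 have uv: "(u, v) \<in> parcs G" by simp
    have "p u \<noteq> p v" using V[OF uv] inj by (auto simp: inj_on_def)
    moreover have "closed_segment (p u) (p v) \<inter> p ` pverts G = {p u, p v}"
      using vert'[OF uv] V[OF uv] by auto
    ultimately show ?case by (simp add: e)
  next
    case (3 e)
    obtain u v where e: "e = (u, v)" by (cases e)
    with 3 have uv: "(u, v) \<in> parcs G" by simp
    then have vu: "(v, u) \<in> parcs G" by (auto simp: E)
    have "closed_segment (p u) (p v) \<inter> closed_segment (p x) (p y) \<subseteq> p ` ({u, v} \<inter> {x, y})"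
      if xy: "(x, y) \<in> parcs G" and ne: "{u, v} \<noteq> {x, y}" for x y
    proof (cases "{u, v} \<inter> {x, y} = {}")
      case True
      then show ?thesis using edge'[OF uv xy] by simp
    next
      case False
      have yx: "(y, x) \<in> parcs G" using xy by (auto simp: E)
      consider "u = x" "v \<noteq> y" | "u = y" "v \<noteq> x" | "v = x" "u \<noteq> y" | "v = y" "u \<noteq> x"
        using False ne by auto
      then show ?thesis
      proof cases
        case 1
        then show ?thesis using share[OF uv, of y] xy by auto
      next
        case 2
        then show ?thesis using share[OF uv, of x] yx by (auto simp: closed_segment_commute)
      next
        case 3
        then show ?thesis using share[OF vu, of y] xy by (auto simp: closed_segment_commute)
      next
        case 4
        then show ?thesis using share[OF vu, of x] yx by (auto simp: closed_segment_commute)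
      qed
    qed
    then show ?case by (auto simp: e)
  qed
  then show ?thesis unfolding planar_def by blast
qed

text \<open>
  Twice the signed area of the triangle \<open>a b z\<close>; its sign tells the side of the line \<open>a b\<close> on
  which \<open>z\<close> lies.
\<close>

definition side :: "complex \<Rightarrow> complex \<Rightarrow> complex \<Rightarrow> real" where
  "side a b z = (Re b - Re a) * (Im z - Im a) - (Im b - Im a) * (Re z - Re a)"

lemma side_on_line: "z \<in> closed_segment a b \<Longrightarrow> side a b z = 0"
  by (erule in_segment_from) (simp add: side_def)

lemma side_convex:
  assumes "z \<in> closed_segment c d" "0 < side a b c * side a b d"
  shows "side a b z \<noteq> 0"
proof -
  obtain t where t: "0 \<le> t" "t \<le> 1" "z = c + t *\<^sub>R (d - c)"
    using assms(1) by (rule in_segment_from)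
  have eq: "side a b z = (1 - t) * side a b c + t * side a b d"
    by (simp add: t(3) side_def algebra_simps)
  consider "0 < side a b c" "0 < side a b d" | "side a b c < 0" "side a b d < 0"
    using assms(2) by (auto simp: zero_less_mult_iff)
  then show ?thesis
  proof cases
    case 1
    then have "0 < side a b z"
      unfolding eq using t by (cases "t = 0") (auto intro: add_nonneg_pos)
    then show ?thesis by simp
  next
    case 2
    then have "(1 - t) * side a b c + t * side a b d < 0"
      using t by (cases "t = 0") (auto intro!: add_nonpos_neg mult_nonneg_nonpos mult_pos_neg)
    then show ?thesis unfolding eq by simp
  qed
qed

lemma segments_disjoint_if_same_side:
  assumes "0 < side a b c * side a b d \<or> 0 < side c d a * side c d b"
  shows "closed_segment a b \<inter> closed_segment c d = {}"
  using assms side_on_line side_convex by blast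

section \<open>A plane drawing of the base graph\<close>

text \<open>
  The seven vertices of a gadget have the following roles: 0 is the top, 1 the bottom, 2 the left
  and 3 the right vertex of a 4-cycle, the rim; 4 is the hub, joined to all other vertices; 5 lies
  in the triangle of hub, right and bottom, and 6 in the triangle of hub, left and top.
\<close>

definition gadget_edges :: "nat rel" where
  "gadget_edges = {(0, 2), (2, 1), (1, 3), (3, 0), (4, 0), (4, 1), (4, 2), (4, 3),
     (5, 4), (5, 3), (5, 1), (6, 4), (6, 2), (6, 0)}"

text \<open>
  Only the top and the bottom lie on the line of real part 1, and everything else lies to the
  right of it, so that both can be reached from the origin. The remaining coordinates are small
  integers for which the only collinear triples with an edge are on the axis through the left
  vertex, the hub and the right vertex.
\<close>

definition role_place :: "nat \<Rightarrow> complex" where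
  "role_place r = [Complex 1 6, Complex 1 (-6), Complex 3 0, Complex 9 0, Complex 5 0,
     Complex 5 (-2), Complex 3 1] ! r"

lemma less_7_cases:
  "r < 7 \<Longrightarrow> r = 0 \<or> r = 1 \<or> r = 2 \<or> r = 3 \<or> r = 4 \<or> r = 5 \<or> r = (6::nat)"
  by linarith

lemma role_place_simps:
  "role_place 0 = Complex 1 6" "role_place (Suc 0) = Complex 1 (-6)" "role_place 2 = Complex 3 0"
  "role_place 3 = Complex 9 0" "role_place 4 = Complex 5 0" "role_place 5 = Complex 5 (-2)"
  "role_place 6 = Complex 3 1"
  by (simp_all add: role_place_def)

lemma role_place_bounds:
  assumes "r < 7"
  shows "1 \<le> Re (role_place r)" "- 6 \<le> Im (role_place r)" "Im (role_place r) \<le> 6"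
  using less_7_cases[OF assms] by (auto simp: role_place_simps)

lemma role_place_inj: "r < 7 \<Longrightarrow> s < 7 \<Longrightarrow> role_place r = role_place s \<Longrightarrow> r = s"
  using less_7_cases[of r] less_7_cases[of s] by (auto simp: role_place_simps)

text \<open>
  The next two lemmas are the finite part of the planarity proof. Every pair consisting of an edge
  and a vertex, or of two edges without a common end, is separated by the line through an edge,
  except for the two collinear triples of left vertex, hub and right vertex.
\<close>

lemma gadget_edge_vertex_sides:
  "\<forall>(r, s) \<in> gadget_edges. \<forall>w \<in> {0, 1, 2, 3, 4, 5, 6}. w \<noteq> r \<longrightarrow> w \<noteq> s \<longrightarrow>
     side (role_place r) (role_place s) (role_place w) \<noteq> 0 \<or>
     (r, s, w) = (4, 2, 3) \<or> (r, s, w) = (4, 3, 2)"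
  by (simp add: gadget_edges_def role_place_simps side_def)

lemma gadget_edge_edge_sides:
  "\<forall>(r, s) \<in> gadget_edges. \<forall>(r', s') \<in> gadget_edges. r \<noteq> r' \<and> r \<noteq> s' \<and> s \<noteq> r' \<and> s \<noteq> s' \<longrightarrow>
     0 < side (role_place r) (role_place s) (role_place r') *
         side (role_place r) (role_place s) (role_place s') \<or>
     0 < side (role_place r') (role_place s') (role_place r) *
         side (role_place r') (role_place s') (role_place s)"
  by (simp add: gadget_edges_def role_place_simps side_def)

lemma gadget_vertex_off_edge:
  assumes e: "(r, s) \<in> gadget_edges" and w: "w < 7" "w \<noteq> r" "w \<noteq> s"
  shows "role_place w \<notin> closed_segment (role_place r) (role_place s)"
proof
  assume on: "role_place w \<in> closed_segment (role_place r) (role_place s)"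
  have "w \<in> {0, 1, 2, 3, 4, 5, 6}" using w(1) by auto
  then have "(r, s, w) = (4, 2, 3) \<or> (r, s, w) = (4, 3, 2)"
    using gadget_edge_vertex_sides e w side_on_line[OF on] by fast
  then have rsw: "r = 4 \<and> s = 2 \<and> w = 3 \<or> r = 4 \<and> s = 3 \<and> w = 2" by simp
  \<comment> \<open>In the two collinear cases w lies on the line of the edge, beyond the hub.\<close>
  obtain t where "0 \<le> t" "t \<le> 1"
      "role_place w = role_place r + t *\<^sub>R (role_place s - role_place r)"
    using on by (rule in_segment_from)
  then show False using rsw by (auto simp: role_place_simps complex_eq_iff)
qed

lemma gadget_edges_disjoint:
  assumes "(r, s) \<in> gadget_edges" "(r', s') \<in> gadget_edges" "{r, s} \<inter> {r', s'} = {}"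
  shows "closed_segment (role_place r) (role_place s) \<inter>
    closed_segment (role_place r') (role_place s') = {}"
proof -
  have "r \<noteq> r' \<and> r \<noteq> s' \<and> s \<noteq> r' \<and> s \<noteq> s'" using assms(3) by auto
  then show ?thesis
    using gadget_edge_edge_sides assms(1,2) by (intro segments_disjoint_if_same_side) fast
qed

text \<open>
  The vertex of role \<open>r < 7\<close> in the gadget \<open>i\<close>. The number 0 is left free for the pole, which is
  joined to the top and the bottom of every gadget.
\<close>

definition gv :: "nat \<Rightarrow> nat \<Rightarrow> nat" where
  "gv i r = Suc (7 * i + r)"

definition base_edges :: "nat \<Rightarrow> nat rel" where
  "base_edges n = (\<Union>i<n. {(0, gv i 0), (0, gv i 1)} \<union> (\<lambda>(r, s). (gv i r, gv i s)) ` gadget_edges)"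

definition base_graph :: "nat \<Rightarrow> nat pair_pre_digraph" where
  "base_graph n = \<lparr>pverts = {..7 * n}, parcs = base_edges n \<union> (base_edges n)\<inverse>\<rparr>"

text \<open>
  The gadgets are stacked vertically. The offset 20 exceeds the height 12 of a gadget, so that
  distinct gadgets lie in disjoint strips.
\<close>

definition place :: "nat \<Rightarrow> complex" where
  "place v = (if v = 0 then 0
     else Complex 0 (20 * real ((v - 1) div 7)) + role_place ((v - 1) mod 7))"

lemma gv_eq_iff: "r < 7 \<Longrightarrow> s < 7 \<Longrightarrow> gv i r = gv j s \<longleftrightarrow> i = j \<and> r = s"
proof
  assume rs: "r < 7" "s < 7" and "gv i r = gv j s"
  then have eq: "7 * i + r = 7 * j + s" by (simp add: gv_def)
  then have "(7 * i + r) div 7 = (7 * j + s) div 7" by simp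
  then have "i = j" using rs by simp
  then show "i = j \<and> r = s" using eq by simp
qed simp

lemma gv_nonzero [simp]: "gv i r \<noteq> 0" "0 \<noteq> gv i r"
  by (simp_all add: gv_def)

lemma base_vertex_cases:
  assumes "v \<in> pverts (base_graph n)"
  obtains "v = 0" | i r where "i < n" "r < 7" "v = gv i r"
proof (cases v)
  case (Suc m)
  then have "m < 7 * n" using assms by (simp add: base_graph_def)
  then have "m div 7 < n" by (simp add: less_mult_imp_div_less mult.commute)
  moreover have "v = gv (m div 7) (m mod 7)" by (simp add: Suc gv_def)
  ultimately show ?thesis using that(2)[of "m div 7" "m mod 7"] by simp
qed (use that in simp)

lemma gv_le: "i < n \<Longrightarrow> r < 7 \<Longrightarrow> gv i r \<le> 7 * n"
  by (simp add: gv_def)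

lemma gv_vertex: "i < n \<Longrightarrow> r < 7 \<Longrightarrow> gv i r \<in> pverts (base_graph n)"
  by (simp add: base_graph_def gv_le)

lemma gadget_edges_roles: "(r, s) \<in> gadget_edges \<Longrightarrow> r < 7 \<and> s < 7 \<and> r \<noteq> s"
  unfolding gadget_edges_def by auto

lemma base_edge_cases:
  assumes "(u, v) \<in> base_edges n"
  obtains i r where "i < n" "r \<in> {0, 1}" "u = 0" "v = gv i r"
  | i r s where "i < n" "(r, s) \<in> gadget_edges" "u = gv i r" "v = gv i s"
  using assms unfolding base_edges_def by auto

lemma pair_graph_base: "pair_graph (base_graph n)"
proof -
  have "u \<in> pverts (base_graph n) \<and> v \<in> pverts (base_graph n) \<and> u \<noteq> v"
    if "(u, v) \<in> base_edges n" for u v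
    using that
    by (cases rule: base_edge_cases)
       (auto dest: gadget_edges_roles simp: gv_eq_iff gv_le base_graph_def)
  then show ?thesis
    by (fastforce simp: pair_graph_iff base_graph_def irrefl_def sym_def)
qed

lemma place_gv: "r < 7 \<Longrightarrow> place (gv i r) = Complex 0 (20 * real i) + role_place r"
  by (simp add: place_def gv_def)

definition strip :: "nat \<Rightarrow> complex set" where
  "strip i = {z. 1 \<le> Re z \<and> 20 * real i - 6 \<le> Im z \<and> Im z \<le> 20 * real i + 6}"

lemma convex_strip: "convex (strip i)"
proof -
  have "strip i = {z. 1 \<le> Re z} \<inter> {z. 20 * real i - 6 \<le> Im z} \<inter> {z. Im z \<le> 20 * real i + 6}"
    by (auto simp: strip_def)
  then show ?thesis
    by (simp add: convex_Int convex_halfspace_Re_ge convex_halfspace_Im_ge convex_halfspace_Im_le)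
qed

lemma place_in_strip: "r < 7 \<Longrightarrow> place (gv i r) \<in> strip i"
  using role_place_bounds[of r] by (simp add: strip_def place_gv)

lemma strips_disjoint: "i \<noteq> j \<Longrightarrow> strip i \<inter> strip j = {}"
proof -
  assume "i \<noteq> j"
  then have "real i + 1 \<le> real j \<or> real j + 1 \<le> real i" by linarith
  then show ?thesis by (auto simp: strip_def)
qed

lemma gadget_segment_strip:
  assumes "(r, s) \<in> gadget_edges"
  shows "closed_segment (place (gv i r)) (place (gv i s)) \<subseteq> strip i"
  using assms gadget_edges_roles[OF assms]
  by (intro closed_segment_subset convex_strip place_in_strip) auto

lemma gadget_segment_eq:
  assumes "(r, s) \<in> gadget_edges"
  shows "closed_segment (place (gv i r)) (place (gv i s)) =
    (+) (Complex 0 (20 * real i)) ` closed_segment (role_place r) (role_place s)"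
  using gadget_edges_roles[OF assms] by (simp add: place_gv closed_segment_translation)

lemma inj_place: "inj_on place (pverts (base_graph n))"
proof (rule inj_onI)
  have zero: "place 0 \<notin> strip i" for i by (simp add: place_def strip_def)
  fix u v assume "u \<in> pverts (base_graph n)" "v \<in> pverts (base_graph n)" and eq: "place u = place v"
  from this(1,2) show "u = v"
  proof (elim base_vertex_cases)
    fix i r j s assume rs: "r < 7" "s < 7" and uv: "u = gv i r" "v = gv j s"
    have "i = j" using strips_disjoint[of i j] place_in_strip rs eq uv by fastforce
    moreover have "r = s" using role_place_inj rs eq uv \<open>i = j\<close> by (simp add: place_gv)
    ultimately show ?thesis using uv by simp
  qed (use zero place_in_strip eq in metis)+
qed

text \<open>
  A segment from the pole at the origin to a top or bottom vertex reaches the half-plane of real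
  part at least 1, which contains all gadgets, only at its end.
\<close>

lemma pole_segment:
  assumes "z \<in> closed_segment (place 0) (place (gv i r))" "r \<in> {0, 1}" "1 \<le> Re z"
  shows "z = place (gv i r)"
proof -
  obtain t where t: "0 \<le> t" "t \<le> 1" "z = place 0 + t *\<^sub>R (place (gv i r) - place 0)"
    using assms(1) by (rule in_segment_from)
  have "Re (place (gv i r)) = 1" using assms(2) by (auto simp: place_gv role_place_simps)
  moreover have "place 0 = 0" by (simp add: place_def)
  ultimately have "t = 1" using t assms(3) by simp
  then show ?thesis using t by simp
qed

lemma base_vertex_off_edge:
  assumes uv: "(u, v) \<in> base_edges n" and w: "w \<in> pverts (base_graph n)" "w \<noteq> u" "w \<noteq> v"
  shows "place w \<notin> closed_segment (place u) (place v)"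
  using uv
proof (cases rule: base_edge_cases)
  case (1 i r)
  then obtain j q where j: "j < n" "q < 7" "w = gv j q"
    using w base_vertex_cases by metis
  show ?thesis
  proof
    assume "place w \<in> closed_segment (place u) (place v)"
    moreover have "1 \<le> Re (place w)" using place_in_strip[of q j] j by (simp add: strip_def)
    ultimately have "place w = place v" using pole_segment 1 by blast
    moreover have "v \<in> pverts (base_graph n)" using 1 gv_vertex by auto
    ultimately show False using w inj_place[of n] by (simp add: inj_on_eq_iff)
  qed
next
  case (2 i r s)
  note seg = gadget_segment_strip[OF 2(2), of i]
  from w(1) show ?thesis
  proof (cases rule: base_vertex_cases)
    case 1
    then have "place w \<notin> strip i" by (simp add: place_def strip_def)
    then show ?thesis using seg 2 by auto
  next
    case j: (2 j q)
    show ?thesis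
    proof (cases "j = i")
      case True
      then have "q \<noteq> r" "q \<noteq> s" using w j 2 by auto
      then have "role_place q \<notin> closed_segment (role_place r) (role_place s)"
        using gadget_vertex_off_edge 2(2) j(2) by blast
      then show ?thesis
        using 2 j True by (auto simp: gadget_segment_eq place_gv)
    next
      case False
      then show ?thesis using seg strips_disjoint[of i j] place_in_strip[of q j] j 2 by fastforce
    qed
  qed
qed

text \<open>
  By the previous lemma the two segments could only meet at a vertex, and no vertex lies on
  an edge of which it is not an end.
\<close>

lemma pole_gadget_segments_disjoint:
  assumes "i < n" "r \<in> {0, 1}" "(x, y) \<in> base_edges n" "0 \<notin> {x, y}" "gv i r \<notin> {x, y}"
  shows "closed_segment (place 0) (place (gv i r)) \<inter> closed_segment (place x) (place y) = {}"
proof -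
  from assms(3,4) obtain j q s where j: "(q, s) \<in> gadget_edges" "x = gv j q" "y = gv j s"
    by (cases rule: base_edge_cases) auto
  have "z = place (gv i r)"
    if "z \<in> closed_segment (place 0) (place (gv i r))" "z \<in> closed_segment (place x) (place y)" for z
    using pole_segment[OF that(1) assms(2)] gadget_segment_strip[OF j(1), of j] that(2) j
    by (auto simp: strip_def)
  moreover have "place (gv i r) \<notin> closed_segment (place x) (place y)"
    using base_vertex_off_edge[OF assms(3), of "gv i r"] assms gv_vertex by auto
  ultimately show ?thesis by blast
qed

lemma base_edges_disjoint:
  assumes uv: "(u, v) \<in> base_edges n" and xy: "(x, y) \<in> base_edges n" and ne: "{u, v} \<inter> {x, y} = {}"
  shows "closed_segment (place u) (place v) \<inter> closed_segment (place x) (place y) = {}"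
  using uv
proof (cases rule: base_edge_cases)
  case (1 i r)
  then show ?thesis using pole_gadget_segments_disjoint[of i n r x y] xy ne by auto
next
  case e: (2 i r s)
  from xy show ?thesis
  proof (cases rule: base_edge_cases)
    case (1 j q)
    then show ?thesis using pole_gadget_segments_disjoint[of j n q u v] uv ne e by (auto simp: Int_commute)
  next
    case f: (2 j q t)
    show ?thesis
    proof (cases "i = j")
      case True
      then have "{r, s} \<inter> {q, t} = {}" using ne e f by auto
      then have "closed_segment (role_place r) (role_place s) \<inter>
          closed_segment (role_place q) (role_place t) = {}"
        using gadget_edges_disjoint e f by blast
      then show ?thesis using e f True by (auto simp: gadget_segment_eq)
    next
      case False
      then show ?thesis
        using gadget_segment_strip[OF e(2), of i] gadget_segment_strip[OF f(2), of j] strips_disjoint e f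
        by fastforce
    qed
  qed
qed

lemma planar_base: "planar (base_graph n)"
proof (rule straight_line_drawing[OF pair_graph_base _ inj_place])
  show "parcs (base_graph n) = base_edges n \<union> (base_edges n)\<inverse>" by (simp add: base_graph_def)
qed (fact base_vertex_off_edge base_edges_disjoint)+

section \<open>Domination in planar extensions of the base graph\<close>

text \<open>
  All planar graphs between the base graph and its triangulations are treated at once.
\<close>

locale base_extension =
  fixes n :: nat and H :: "nat pair_pre_digraph"
  assumes planar: "planar H" and graph: "pair_graph H"
    and verts: "pverts H = pverts (base_graph n)" and arcs: "parcs (base_graph n) \<subseteq> parcs H"
begin

lemma arcs_sym: "(u, v) \<in> parcs H \<Longrightarrow> (v, u) \<in> parcs H"
  using graph by (auto simp: pair_graph_iff dest: symD)

lemma gadget_arc: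
  assumes "i < n" "(r, s) \<in> gadget_edges \<union> gadget_edges\<inverse>"
  shows "(gv i r, gv i s) \<in> parcs H"
proof -
  have "(gv i r, gv i s) \<in> base_edges n \<union> (base_edges n)\<inverse>"
    using assms unfolding base_edges_def by force
  then show ?thesis using arcs by (auto simp: base_graph_def)
qed

lemma pole_arc:
  assumes "i < n" "r \<in> {0, 1}"
  shows "(gv i r, 0) \<in> parcs H"
proof -
  have "(0, gv i r) \<in> base_edges n" using assms unfolding base_edges_def by auto
  then show ?thesis using arcs by (auto simp: base_graph_def)
qed

lemma hub_arc: "i < n \<Longrightarrow> r < 7 \<Longrightarrow> r \<noteq> 4 \<Longrightarrow> (gv i r, gv i 4) \<in> parcs H"
  using less_7_cases[of r] by (intro gadget_arc) (auto simp: gadget_edges_def)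

definition rim :: "nat \<Rightarrow> nat set" where
  "rim i = gv i ` {0, 1, 2, 3}"

definition core :: "nat \<Rightarrow> nat set" where
  "core i = gv i ` {4, 5, 6}"

definition gadget :: "nat \<Rightarrow> nat set" where
  "gadget i = gv i ` {..<7}"

lemma gadget_eq: "gadget i = rim i \<union> core i"
proof -
  have "{..<7} = {0, 1, 2, 3} \<union> {4, 5, 6::nat}" by auto
  then show ?thesis unfolding gadget_def rim_def core_def by (metis image_Un)
qed

lemma rim_core_disjoint: "rim i \<inter> core i = {}"
  by (auto simp: rim_def core_def gv_eq_iff)

lemma gadgets_disjoint: "i \<noteq> j \<Longrightarrow> gadget i \<inter> gadget j = {}"
  by (auto simp: gadget_def gv_eq_iff)

text \<open>
  Every other gadget is connected to the pole through its own hub and top, so that the part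
  outside the gadget \<open>i\<close> is joined to the pole without using the rim of \<open>i\<close>.
\<close>

lemma walk_to_pole:
  assumes v: "v \<in> pverts H" "v \<notin> gadget i" and i: "i < n"
  shows "(v, 0) \<in> walk_avoiding H (rim i)"
proof -
  have zero: "0 \<notin> rim i" by (auto simp: rim_def)
  from v(1) have "v \<in> pverts (base_graph n)" by (simp add: verts)
  then show ?thesis
  proof (cases rule: base_vertex_cases)
    case 1
    then show ?thesis by (simp add: walk_avoiding_def)
  next
    case (2 j r)
    then have "j \<noteq> i" using v(2) by (auto simp: gadget_def)
    then have off: "gv j s \<notin> rim i" if "s < 7" for s
      using that by (auto simp: rim_def gv_eq_iff)
    have "(v, gv j 4) \<in> walk_avoiding H (rim i)"
      using 2 hub_arc off
      by (cases "r = 4") (auto simp: walk_avoiding_def[of _ "rim i"] intro!: r_into_rtrancl)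
    moreover have "(gv j 4, gv j 0) \<in> walk_avoiding H (rim i)"
      using 2 off by (intro walk_avoiding_arc gadget_arc) (auto simp: gadget_edges_def)
    moreover have "(gv j 0, 0) \<in> walk_avoiding H (rim i)"
      using 2 off zero by (intro walk_avoiding_arc pole_arc) auto
    ultimately show ?thesis by (metis walk_avoiding_trans)
  qed
qed

text \<open>
  The rim separates the core from the rest of the graph. An edge from the core to the outside
  gives a walk from the hub to the pole off the rim. Together with the edges of the rim, from the
  hub to left and right, and from the pole to top and bottom, this walk is a subdivided
  \<open>K\<^sub>3\<^sub>,\<^sub>3\<close> with parts \<open>{top, bottom, hub}\<close> and \<open>{left, right, pole}\<close>.
\<close>

lemma core_neighbours:
  assumes i: "i < n" and u: "u \<in> core i" and uv: "(u, v) \<in> parcs H"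
  shows "v \<in> gadget i"
proof (rule ccontr)
  assume v: "v \<notin> gadget i"
  have vH: "v \<in> pverts H" using uv graph by (auto simp: pair_graph_iff)
  have off: "u \<notin> rim i" "gv i 4 \<notin> rim i" "v \<notin> rim i"
    using u v rim_core_disjoint[of i] by (auto simp: gadget_eq core_def)
  have "(gv i 4, u) \<in> walk_avoiding H (rim i)"
  proof (cases "u = gv i 4")
    case True
    then show ?thesis by (simp add: walk_avoiding_def)
  next
    case False
    then have "(u, gv i 4) \<in> parcs H" using u i hub_arc by (auto simp: core_def)
    then show ?thesis using off arcs_sym by (intro walk_avoiding_arc) auto
  qed
  moreover have "(u, v) \<in> walk_avoiding H (rim i)" using uv off by (intro walk_avoiding_arc)
  moreover have "(v, 0) \<in> walk_avoiding H (rim i)" using vH v i by (rule walk_to_pole)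
  ultimately have walk: "(gv i 4, 0) \<in> walk_avoiding H (rim i)" by (metis walk_avoiding_trans)
  have rim: "rim i = {gv i 0, gv i 1, gv i 2, gv i 3}" by (simp add: rim_def)
  show False
  proof (rule planar_no_subdivided_K33[OF graph planar])
    show "distinct [gv i 0, gv i 1, gv i 4, gv i 2, gv i 3, 0]" by (simp add: gv_eq_iff)
    show "(gv i 4, 0) \<in> walk_avoiding H {gv i 0, gv i 1, gv i 2, gv i 3}" using walk rim by simp
  qed (use i in \<open>auto intro!: gadget_arc pole_arc walk_avoiding_arc simp: gadget_edges_def gv_eq_iff\<close>)
qed

text \<open>
  A rim vertex cannot be joined to the core vertex in the opposite triangle, since that edge
  completes a \<open>K\<^sub>3\<^sub>,\<^sub>3\<close> inside the gadget. For the edge from the top to the vertex 5, the parts are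
  \<open>{top, hub, bottom}\<close> and \<open>{left, right, 5}\<close>; the other cases are symmetric to it.
\<close>

lemma rim_misses_core_vertex:
  assumes i: "i < n" and v: "v \<in> rim i"
  shows "(v, gv i 5) \<notin> parcs H \<or> (v, gv i 6) \<notin> parcs H"
proof (rule ccontr)
  assume "\<not> ?thesis"
  then have new: "(v, gv i 5) \<in> parcs H" "(v, gv i 6) \<in> parcs H" by auto
  note K33 = planar_no_K33[OF graph planar]
  consider "v = gv i 0" | "v = gv i 1" | "v = gv i 2" | "v = gv i 3"
    using v by (auto simp: rim_def)
  then show False
  proof cases
    case 1
    show False
      by (rule K33[of "gv i 0" "gv i 4" "gv i 1" "gv i 2" "gv i 3" "gv i 5"])
         (use new 1 i in \<open>auto intro!: gadget_arc simp: gadget_edges_def gv_eq_iff\<close>)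
  next
    case 2
    show False
      by (rule K33[of "gv i 1" "gv i 4" "gv i 0" "gv i 2" "gv i 3" "gv i 6"])
         (use new 2 i in \<open>auto intro!: gadget_arc simp: gadget_edges_def gv_eq_iff\<close>)
  next
    case 3
    show False
      by (rule K33[of "gv i 2" "gv i 4" "gv i 3" "gv i 0" "gv i 1" "gv i 5"])
         (use new 3 i in \<open>auto intro!: gadget_arc simp: gadget_edges_def gv_eq_iff\<close>)
  next
    case 4
    show False
      by (rule K33[of "gv i 3" "gv i 4" "gv i 2" "gv i 0" "gv i 1" "gv i 6"])
         (use new 4 i in \<open>auto intro!: gadget_arc simp: gadget_edges_def gv_eq_iff\<close>)
  qed
qed

lemma domination_number_le_Suc: "domination_number H \<le> Suc n"
proof -
  let ?D = "insert 0 ((\<lambda>i. gv i 4) ` {..<n})"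
  have "dominating_set H ?D"
    unfolding dominating_set_def verts
  proof (intro conjI ballI)
    show "?D \<subseteq> pverts (base_graph n)" using gv_vertex by (auto simp: base_graph_def)
    fix v assume "v \<in> pverts (base_graph n)"
    then show "v \<in> ?D \<or> (\<exists>u\<in>?D. (v, u) \<in> parcs H)"
    proof (cases rule: base_vertex_cases)
      case (2 i r)
      then show ?thesis using hub_arc[of i r] by (cases "r = 4") auto
    qed simp
  qed
  then have "domination_number H \<le> card ?D" by (rule domination_number_le)
  also have "card ?D \<le> Suc (card ((\<lambda>i. gv i 4) ` {..<n}))" by (rule card_insert_le_m1) simp_all
  also have "\<dots> \<le> Suc n" using card_image_le[of "{..<n}"] by fastforce
  finally show ?thesis .
qed

lemma core_dominated_from_gadget:
  assumes S: "dominating_set H S" and i: "i < n" and v: "v \<in> core i"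
  obtains u where "u \<in> S" "u \<in> gadget i" "u = v \<or> (u, v) \<in> parcs H"
proof -
  have "v \<in> pverts H" using v i gv_vertex by (auto simp: core_def verts)
  then consider "v \<in> S" | u where "u \<in> S" "(v, u) \<in> parcs H"
    using S by (auto simp: dominating_set_def)
  then show ?thesis
    using that core_neighbours[OF i v] arcs_sym v by cases (auto simp: gadget_eq)
qed

text \<open>
  The set contains a vertex of every gadget, as it dominates the hub of that gadget. If it missed
  the rim, then it would contain vertices inside and outside the core but no edge between them.
\<close>

lemma connected_dominating_meets_rim:
  assumes S: "connected_dominating_set H S" and i: "i < n" and n: "2 \<le> n"
  shows "S \<inter> rim i \<noteq> {}"
proof
  assume no_rim: "S \<inter> rim i = {}"
  have dom: "dominating_set H S" and con: "Digraph_Component.connected (with_proj H \<restriction> S)"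
    using S by (auto simp: connected_dominating_set_def)
  obtain j where j: "j < n" "j \<noteq> i"
  proof
    show "(if i = 0 then 1 else 0) < n" "(if i = 0 then 1 else 0) \<noteq> i" using n by auto
  qed
  obtain u where u: "u \<in> S" "u \<in> gadget i"
    using core_dominated_from_gadget[OF dom i, of "gv i 4"] by (auto simp: core_def)
  obtain w where w: "w \<in> S" "w \<in> gadget j"
    using core_dominated_from_gadget[OF dom j(1), of "gv j 4"] by (auto simp: core_def)
  have "u \<in> core i" using u no_rim by (auto simp: gadget_eq)
  moreover have "w \<notin> core i" using w gadgets_disjoint[OF j(2)] by (auto simp: gadget_eq)
  moreover have "sym (parcs H)" using graph by (simp add: pair_graph_iff)
  ultimately obtain x y where "x \<in> core i" "y \<in> S" "y \<notin> core i" "(x, y) \<in> parcs H"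
    using connected_cut_arc[OF con, of u "core i" w] u w by metis
  then show False using core_neighbours[OF i] no_rim by (auto simp: gadget_eq)
qed

text \<open>
  A rim vertex of the set leaves one vertex of the core undominated, and this vertex can only be
  dominated from within the gadget.
\<close>

lemma connected_dominating_gadget_card:
  assumes S: "connected_dominating_set H S" and i: "i < n" and n: "2 \<le> n"
  shows "2 \<le> card (S \<inter> gadget i)"
proof -
  have dom: "dominating_set H S" using S by (simp add: connected_dominating_set_def)
  obtain v where v: "v \<in> S" "v \<in> rim i" using connected_dominating_meets_rim[OF assms] by auto
  obtain c where c: "c \<in> core i" "(v, c) \<notin> parcs H"
    using rim_misses_core_vertex[OF i v(2)] by (auto simp: core_def)
  obtain u where u: "u \<in> S" "u \<in> gadget i" "u = c \<or> (u, c) \<in> parcs H"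
    using core_dominated_from_gadget[OF dom i c(1)] .
  have "u \<noteq> v" using u c v rim_core_disjoint[of i] by auto
  moreover have "{u, v} \<subseteq> S \<inter> gadget i" using u v by (auto simp: gadget_eq)
  moreover have "finite (S \<inter> gadget i)" by (simp add: gadget_def)
  ultimately show ?thesis by (metis card_2_iff card_mono)
qed

lemma connected_dominating_card:
  assumes S: "connected_dominating_set H S" and n: "2 \<le> n"
  shows "2 * n \<le> card S"
proof -
  have "finite (pverts H)" "S \<subseteq> pverts H"
    using S graph by (auto simp: pair_graph_iff connected_dominating_set_def dominating_set_def)
  then have fin: "finite S" by (rule finite_subset[rotated])
  have "2 * n = (\<Sum>i<n. 2)" by simp
  also have "\<dots> \<le> (\<Sum>i<n. card (S \<inter> gadget i))"
    using connected_dominating_gadget_card[OF S _ n] by (intro sum_mono) auto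
  also have "\<dots> = card (\<Union>i<n. S \<inter> gadget i)"
    using fin gadgets_disjoint by (intro card_UN_disjoint[symmetric]) (auto simp: disjoint_iff)
  also have "\<dots> \<le> card S" using fin by (intro card_mono) auto
  finally show ?thesis .
qed

end

lemma connected_base:
  shows "Digraph_Component.connected (with_proj (base_graph n))"
proof (rule connectedI_root[of 0])
  interpret base_extension n "base_graph n"
    by (rule base_extension.intro[OF planar_base pair_graph_base refl subset_refl])
  show zero: "0 \<in> pverts (base_graph n)" by (simp add: base_graph_def)
  show "sym (parcs (base_graph n))" using pair_graph_base[of n] by (simp add: pair_graph_iff)
  fix v assume "v \<in> pverts (base_graph n)"
  then show "(0, v) \<in> rtrancl_on (pverts (base_graph n)) (parcs (base_graph n))"
  proof (cases rule: base_vertex_cases)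
    case 1
    then show ?thesis using zero by simp
  next
    case (2 i r)
    note step = rtrancl_on_into_rtrancl_on[where F = "pverts (base_graph n)"
        and r = "parcs (base_graph n)"]
    have "(0, gv i 0) \<in> parcs (base_graph n)" using pole_arc[of i 0] 2 arcs_sym by simp
    then have "(0, gv i 0) \<in> rtrancl_on (pverts (base_graph n)) (parcs (base_graph n))"
      using step[OF rtrancl_on_refl[OF zero]] gv_vertex 2 by simp
    then have *: "(0, gv i 4) \<in> rtrancl_on (pverts (base_graph n)) (parcs (base_graph n))"
      using step[of 0 "gv i 0" "gv i 4"] hub_arc[of i 0] gv_vertex 2 by simp
    show ?thesis
      using step[OF *, of v] * hub_arc[of i r] arcs_sym gv_vertex[of i n r] 2 by (cases "r = 4") auto
  qed
qed

theorem proposition16: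
  shows "\<exists>H :: nat \<Rightarrow> nat pair_pre_digraph.
    (\<forall>k\<ge>1. plane_triangulation (H k)) \<and>
    (\<forall>M :: int. \<exists>k\<ge>1.
       int (connected_domination_number (H k)) - int (domination_number (H k)) \<ge> M)"
proof -
  have "\<exists>H. plane_triangulation H \<and> pverts H = pverts (base_graph (Suc k)) \<and>
      parcs (base_graph (Suc k)) \<subseteq> parcs H" for k
    using maximal_planar_extension[OF pair_graph_base planar_base connected_base] by metis
  then obtain H where H: "\<And>k. plane_triangulation (H k)"
    "\<And>k. pverts (H k) = pverts (base_graph (Suc k))" "\<And>k. parcs (base_graph (Suc k)) \<subseteq> parcs (H k)"
    by metis
  have gap: "int (connected_domination_number (H k)) - int (domination_number (H k)) \<ge> int k"
    if "1 \<le> k" for k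
  proof -
    have tri: "pair_graph (H k)" "Digraph_Component.connected (with_proj (H k))" "planar (H k)"
      using H(1) by (auto simp: plane_triangulation_def)
    interpret base_extension "Suc k" "H k"
      by (rule base_extension.intro[OF tri(3,1) H(2,3)])
    have "2 * Suc k \<le> connected_domination_number (H k)"
      using connected_domination_number_ge[OF tri(1,2)] connected_dominating_card that by simp
    then have "k + domination_number (H k) \<le> connected_domination_number (H k)"
      using domination_number_le_Suc by simp
    then show ?thesis by linarith
  qed
  have "\<exists>k\<ge>1. int (connected_domination_number (H k)) - int (domination_number (H k)) \<ge> M" for M :: int
    using gap[of "max 1 (nat M)"] by (intro exI[of _ "max 1 (nat M)"]) linarith
  then show ?thesis using H(1) by blast
qed

end
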